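(* Let $n\ge 1$, let $F(x_1,\dots,x_{n+1})$ be a homogeneous quadratic polynomial on $\mathbb{R}^{n+1}$, let $m$ be any fixed integer with $1\le m\le n$, and let $M_m\subset S^n$ be the set of $m$-mid-points. Then $$\frac{1}{\mathrm{vol}(S^n)}\int_{S^n}F\,dS=\frac{1}{\#M_m}\sum_{x\in M_m}F(x),$$ where $\mathrm{vol}(S^n)$ is the $n$-dimensional volume of $S^n$ and $\#M_m$ is the number of points in $M_m$.
   Context: $S^n$ is the unit sphere in $\mathbb{R}^{n+1}$ and $dS$ is its standard (rotation-invariant) volume measure. The set $M_m$ of $m$-mid-points is the set of all points of $\mathbb{R}^{n+1}$ having exactly $m$ non-zero coordinates among the $n+1$ coordinates, each non-zero coordinate being equal to $+1/\sqrt{m}$ or $-1/\sqrt{m}$ (all choices of the $m$ positions and all choices of signs are included); i.e. all vectors with $m$ coordinates $\pm1$ and the others $0$, scaled to lie on the unit sphere $S^n$. Real coefficients are assumed. *)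

theory Defs
  imports "HOL-Analysis.Analysis" "HOL-Library.Poly_Mapping"
begin

text \<open>
  The surface measure of the unit sphere, normalised by the polar decomposition
  \<open>dx = r\<^sup>d\<^sup>-\<^sup>1 dr dS\<close>, where \<open>d\<close> is the dimension of the ambient space: the surface measure
  of a set \<open>A\<close> of unit vectors is \<open>d\<close> times the Lebesgue measure of the cone of all \<open>r x\<close> with
  \<open>0 < r < 1\<close> and \<open>x \<in> A\<close>.  Here \<^term>\<open>sgn x\<close> is the unit vector \<open>x / norm x\<close>.
\<close>

definition sphere_measure :: "'a::euclidean_space measure" where
  "sphere_measure =
     scale_measure (of_nat DIM('a))
       (distr (restrict_space lborel (ball 0 1 - {0})) (restrict_space borel (sphere 0 1)) sgn)"

text \<open>
  Multivariate polynomials with variables indexed by \<open>'n\<close> are finitely supported maps from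
  exponent vectors to coefficients.
\<close>

type_synonym 'n real_mpoly = "('n \<Rightarrow>\<^sub>0 nat) \<Rightarrow>\<^sub>0 real"

definition mpoly_eval :: "'n::finite real_mpoly \<Rightarrow> real ^ 'n \<Rightarrow> real" where
  "mpoly_eval p x =
     (\<Sum>\<alpha> \<in> Poly_Mapping.keys p.
        Poly_Mapping.lookup p \<alpha> * (\<Prod>i\<in>UNIV. (x $ i) ^ Poly_Mapping.lookup \<alpha> i))"

text \<open>The zero polynomial counts as homogeneous of every degree.\<close>

definition homogeneous_mpoly :: "nat \<Rightarrow> 'n::finite real_mpoly \<Rightarrow> bool" where
  "homogeneous_mpoly d p \<longleftrightarrow>
     (\<forall>\<alpha> \<in> Poly_Mapping.keys p. (\<Sum>i\<in>UNIV. Poly_Mapping.lookup \<alpha> i) = d)"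

definition mid_points :: "nat \<Rightarrow> (real ^ 'n::finite) set" where
  "mid_points m =
     {x. card {i. x $ i \<noteq> 0} = m \<and>
         (\<forall>i. x $ i \<noteq> 0 \<longrightarrow> x $ i = 1 / sqrt (real m) \<or> x $ i = - (1 / sqrt (real m)))}"

lemma space_sphere_measure [simp]: "space sphere_measure = sphere 0 1"
  by (simp add: sphere_measure_def space_scale_measure space_restrict_space)

lemma sets_sphere_measure [measurable_cong]:
  "sets sphere_measure = sets (restrict_space borel (sphere 0 1))"
  by (simp add: sphere_measure_def)

lemma emeasure_sphere_measure:
  fixes A :: "'a::euclidean_space set"
  assumes "A \<in> sets sphere_measure"
  shows "emeasure sphere_measure A =
    of_nat DIM('a) * emeasure lborel {x \<in> ball 0 1 - {0}. sgn x \<in> A}"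
proof -
  have sgn: "sgn \<in> measurable (restrict_space lborel (ball 0 1 - {0 :: 'a}))
      (restrict_space borel (sphere 0 1))"
    by (intro measurable_restrict_space2 measurable_restrict_space1)
      (auto simp: space_restrict_space norm_sgn sgn_div_norm)
  show ?thesis
    using assms measurable_sets[OF sgn, of A]
    by (auto simp: sphere_measure_def emeasure_distr[OF sgn] space_restrict_space
        emeasure_restrict_space intro!: arg_cong[where f = "emeasure lborel"] arg_cong2[where f = "(*)"])
qed

lemma emeasure_sphere_measure_sphere:
  "emeasure sphere_measure (sphere (0 :: 'a::euclidean_space) 1) =
    ennreal (real DIM('a) * unit_ball_vol (real DIM('a)))"
proof -
  have "{x \<in> ball 0 1 - {0 :: 'a}. sgn x \<in> sphere 0 1} = ball 0 1 - {0}"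
    by (auto simp: norm_sgn)
  moreover have "emeasure lborel (ball 0 1 - {0 :: 'a}) = emeasure lborel (ball (0 :: 'a) 1)"
    by (intro emeasure_Diff_null_set) auto
  moreover have "emeasure lborel (ball (0 :: 'a) 1) = ennreal (unit_ball_vol (real DIM('a)))"
    by (simp add: emeasure_ball)
  moreover have "sphere (0 :: 'a) 1 \<in> sets sphere_measure"
    using sets.top[of "sphere_measure :: 'a measure"] by simp
  ultimately show ?thesis
    by (simp add: emeasure_sphere_measure ennreal_mult ennreal_of_nat_eq_real_of_nat)
qed

text \<open>The sort constraint \<open>wellorder\<close> is inherited from \<open>measure_orthogonal_image\<close>.\<close>

lemma sphere_measure_rotation_invariant:
  fixes f :: "real ^ 'n::{finite,wellorder} \<Rightarrow> real ^ 'n::_"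
  assumes f: "orthogonal_transformation f" and A: "A \<in> sets sphere_measure"
  shows "emeasure sphere_measure (f ` A) = emeasure sphere_measure A"
proof -
  define C where "C B = {x \<in> ball 0 1 - {0 :: real ^ 'n::_}. sgn x \<in> B}" for B
  have lin: "linear f" and nrm: "norm (f x) = norm x" for x
    using f by (auto simp: orthogonal_transformation)
  obtain g where g: "orthogonal_transformation g" "\<And>x. g (f x) = x" "\<And>x. f (g x) = x"
    using f orthogonal_transformation_inv[OF f] orthogonal_transformation_bij[OF f]
    by (metis bij_inv_eq_iff)
  have gl: "linear g" and gn: "norm (g x) = norm x" for x
    using g(1) by (auto simp: orthogonal_transformation)
  have Ab: "A \<in> sets borel" "A \<subseteq> sphere 0 1"
    using A by (auto simp: sets_sphere_measure sets_restrict_space_iff)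
  have fA: "f ` A = g -` A"
  proof (intro set_eqI iffI)
    fix x assume "x \<in> g -` A"
    then show "x \<in> f ` A"
      using g(3)[of x] by (intro image_eqI[where x = "g x"]) auto
  qed (auto simp: g(2))
  have gm: "g \<in> borel_measurable borel"
    using gl by (intro borel_measurable_continuous_onI linear_continuous_on) (simp add: linear_linear)
  have "f ` A \<in> sets borel"
    using measurable_sets[OF gm Ab(1)] fA by simp
  then have fA': "f ` A \<in> sets sphere_measure"
    using Ab nrm by (auto simp: sets_sphere_measure sets_restrict_space_iff)
  have sgnf: "sgn (f x) = f (sgn x)" for x
    using lin nrm by (simp add: sgn_div_norm linear_cmul)
  have sgng: "sgn (g x) = g (sgn x)" for x
    using gl gn by (simp add: sgn_div_norm linear_cmul)
  have CfA: "C (f ` A) = f ` C A"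
  proof
    show "C (f ` A) \<subseteq> f ` C A"
    proof
      fix x assume x: "x \<in> C (f ` A)"
      then have "g x \<in> C A"
        using g gn[of x] by (auto simp: C_def sgng fA)
      then show "x \<in> f ` C A"
        using g(3)[of x] by (metis imageI)
    qed
    show "f ` C A \<subseteq> C (f ` A)"
    proof (rule image_subsetI)
      fix x assume x: "x \<in> C A"
      then have "f x \<noteq> 0"
        using nrm[of x] by (auto simp: C_def)
      then show "f x \<in> C (f ` A)"
        using x nrm[of x] by (simp add: C_def sgnf)
    qed
  qed
  have C_sets: "C B \<in> sets borel" if "B \<in> sets borel" for B
  proof -
    have "sgn -` B \<inter> space borel \<in> sets (borel :: (real ^ 'n::_) measure)"
      using that by (intro measurable_sets[of _ _ borel]) (auto simp: sgn_div_norm)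
    moreover have "C B = (ball 0 1 - {0}) \<inter> (sgn -` B \<inter> space borel)"
      by (auto simp: C_def)
    ultimately show ?thesis
      by auto
  qed
  have C_lm: "C B \<in> lmeasurable" if "B \<in> sets borel" for B
    using C_sets[OF that]
    by (intro bounded_set_imp_lmeasurable bounded_subset[OF bounded_ball[of 0 1]]) (auto simp: C_def)
  have emeq: "emeasure lborel (C B) = ennreal (measure lebesgue (C B))" if "B \<in> sets borel" for B
    using emeasure_eq_measure2[OF C_lm[OF that]] C_sets[OF that] by (simp add: emeasure_completion)
  have "measure lebesgue (C (f ` A)) = measure lebesgue (C A)"
    unfolding CfA by (rule measure_orthogonal_image[OF f C_lm[OF Ab(1)]])
  then show ?thesis
    using A fA' emeq[OF Ab(1)] emeq[OF \<open>f ` A \<in> sets borel\<close>]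
    by (simp add: emeasure_sphere_measure C_def)
qed

lemma mid_points_subset_sphere:
  assumes "0 < m"
  shows "mid_points m \<subseteq> sphere (0 :: real ^ 'n) 1"
proof
  fix x :: "real ^ 'n" assume x: "x \<in> mid_points m"
  have "(norm x)\<^sup>2 = (\<Sum>i\<in>UNIV. (x $ i)\<^sup>2)"
    by (simp add: norm_vec_def L2_set_def sum_nonneg)
  also have "\<dots> = (\<Sum>i | x $ i \<noteq> 0. (x $ i)\<^sup>2)"
    by (intro sum.mono_neutral_right) auto
  also have "\<dots> = (\<Sum>i | x $ i \<noteq> 0. 1 / real m)"
    using x by (intro sum.cong) (auto simp: mid_points_def power_divide)
  also have "\<dots> = 1"
    using x assms by (simp add: mid_points_def)
  finally show "x \<in> sphere 0 1"
    by (simp add: power2_eq_1_iff) (use norm_ge_zero[of x] in linarith)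
qed

lemma finite_mid_points: "finite (mid_points m :: (real ^ 'n) set)"
proof -
  let ?S = "{0, 1 / sqrt (real m), - (1 / sqrt (real m))}"
  have fin: "finite (UNIV \<rightarrow>\<^sub>E ?S :: ('n \<Rightarrow> real) set)"
    by (rule finite_PiE) simp_all
  have "mid_points m \<subseteq> vec_lambda ` (UNIV \<rightarrow>\<^sub>E ?S :: ('n \<Rightarrow> real) set)"
  proof
    fix x :: "real ^ 'n" assume x: "x \<in> mid_points m"
    have "vec_nth x \<in> UNIV \<rightarrow>\<^sub>E ?S"
      using x by (intro PiE_I) (simp_all add: mid_points_def, blast)
    then have "vec_lambda (vec_nth x) \<in> vec_lambda ` (UNIV \<rightarrow>\<^sub>E ?S :: ('n \<Rightarrow> real) set)"
      by (rule imageI)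
    then show "x \<in> vec_lambda ` (UNIV \<rightarrow>\<^sub>E ?S :: ('n \<Rightarrow> real) set)"
      by (simp only: vec_nth_inverse)
  qed
  then show ?thesis
    by (rule finite_subset[OF _ finite_imageI[OF fin]])
qed

end

theory Submission
  imports Defs
begin

text \<open>
  Both sides are averages over a subset of the unit sphere against a measure that is invariant
  under permutations and sign changes of the coordinates, and these symmetries alone
  determine the average of a quadratic form.  Reflecting the \<open>i\<close>-th coordinate negates every
  monomial in which \<open>x\<^sub>i\<close> has odd degree, so such a monomial has integral \<open>0\<close>.  The remaining monomials
  of degree 2 are the squares \<open>x\<^sub>i\<^sup>2\<close>; they all have the same integral because the coordinates can be
  swapped, and they add up to 1 on the unit sphere, so each has average \<open>1 / N\<close> with \<open>N\<close> the number
  of coordinates.  Hence the average is the trace of the form divided by \<open>N\<close>, whatever the measure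
  (\<open>integral_mpoly_eval_degree_2\<close>).

  This is applied to the surface measure and to the counting measure on the mid-points.
  The invariance of the surface measure reduces to that of Lebesgue measure on open boxes, which
  signed permutations map to open boxes with the same side lengths up to order
  (\<open>distr_lborel_signed_permutation\<close>).
\<close>

section \<open>Signed permutations of the coordinates\<close>

definition signed_permutation :: "('n \<Rightarrow> real) \<Rightarrow> ('n \<Rightarrow> 'n) \<Rightarrow> real ^ 'n \<Rightarrow> real ^ 'n::finite" where
  "signed_permutation e p x = (\<chi> i. e i * x $ p i)"

lemma signed_permutation_nth [simp]: "signed_permutation e p x $ i = e i * x $ p i"
  by (simp add: signed_permutation_def)

lemma linear_signed_permutation: "linear (signed_permutation e p)"
  by (intro linearI) (simp_all add: vec_eq_iff algebra_simps)

lemma borel_measurable_signed_permutation [measurable]: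
  "signed_permutation e p \<in> borel_measurable borel"
  by (intro borel_measurable_continuous_onI linear_continuous_on)
    (simp add: linear_linear linear_signed_permutation)

lemma norm_signed_permutation:
  assumes p: "bij p" and e: "range e \<subseteq> {1, -1}"
  shows "norm (signed_permutation e p x) = norm x"
proof -
  have "(e i)\<^sup>2 = 1" for i
    using e by (auto simp: image_subset_iff power2_eq_1_iff)
  then have "(\<Sum>i\<in>UNIV. (signed_permutation e p x $ i)\<^sup>2) = (\<Sum>i\<in>UNIV. (x $ p i)\<^sup>2)"
    by (simp add: power_mult_distrib)
  also have "\<dots> = (\<Sum>i\<in>UNIV. (x $ i)\<^sup>2)"
    by (rule sum.reindex_bij_betw[OF p])
  finally show ?thesis
    by (simp add: norm_vec_def L2_set_def)
qed

lemma bij_signed_permutation: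
  assumes p: "bij p" and e: "range e \<subseteq> {1, -1}"
  shows "bij (signed_permutation e p)"
proof -
  have "inj (signed_permutation e p)"
    using norm_signed_permutation[OF assms]
    by (metis linear_injective_0 linear_signed_permutation norm_eq_zero)
  then show ?thesis
    by (simp add: bij_def linear_injective_imp_surjective linear_signed_permutation)
qed

section \<open>Quadratic forms against a symmetric measure on the unit sphere\<close>

locale signed_permutation_invariant_measure = finite_measure M
  for M :: "(real ^ 'n::finite) measure" +
  assumes space_subset: "space M \<subseteq> sphere 0 1"
    and borel: "(\<lambda>x. x) \<in> borel_measurable M"
    and measurable: "bij p \<Longrightarrow> range e \<subseteq> {1, -1} \<Longrightarrow> signed_permutation e p \<in> measurable M M"
    and invariant: "bij p \<Longrightarrow> range e \<subseteq> {1, -1} \<Longrightarrow> distr M M (signed_permutation e p) = M"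
begin

lemma integral_signed_permutation:
  fixes f :: "real ^ 'n \<Rightarrow> real"
  assumes "bij p" "range e \<subseteq> {1, -1}" and f: "f \<in> borel_measurable M"
  shows "(LINT x|M. f (signed_permutation e p x)) = (LINT x|M. f x)"
  using integral_distr[OF measurable[OF assms(1,2)] f] invariant[OF assms(1,2)] by simp

lemma borel_measurable_nth [measurable]: "(\<lambda>x. x $ i) \<in> borel_measurable M"
  using measurable_compose[OF borel borel_measurable_nth] .

lemma integrable_monomial: "integrable M (\<lambda>x. \<Prod>i\<in>UNIV. (x $ i) ^ a i)"
proof (rule integrable_const_bound[where B = 1])
  show "AE x in M. norm (\<Prod>i\<in>UNIV. (x $ i) ^ a i) \<le> 1"
  proof (rule AE_I2)
    fix x assume "x \<in> space M"
    then have "\<bar>x $ i\<bar> \<le> 1" for i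
      using space_subset component_le_norm_cart[of x i] by auto
    then show "norm (\<Prod>i\<in>UNIV. (x $ i) ^ a i) \<le> 1"
      by (simp add: abs_prod power_abs prod_le_1 power_le_one)
  qed
qed measurable

text \<open>The reflection in the coordinate of odd degree negates the monomial.\<close>

lemma integral_odd_monomial:
  assumes "odd (a k)"
  shows "(LINT x|M. (\<Prod>i\<in>UNIV. (x $ i) ^ a i)) = 0"
proof -
  define e where "e i = (if i = k then -1 else 1 :: real)" for i
  have "(\<Prod>i\<in>UNIV. e i ^ a i) = -1"
  proof -
    have "(\<Prod>i\<in>UNIV. e i ^ a i) = (\<Prod>i\<in>UNIV. if i = k then -1 else 1)"
      using assms by (intro prod.cong) (auto simp: e_def)
    then show ?thesis
      by simp
  qed
  then have "(\<Prod>i\<in>UNIV. (signed_permutation e id x $ i) ^ a i) = - (\<Prod>i\<in>UNIV. (x $ i) ^ a i)" for x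
    by (simp add: power_mult_distrib prod.distrib)
  moreover have "(LINT x|M. (\<Prod>i\<in>UNIV. (signed_permutation e id x $ i) ^ a i))
      = (LINT x|M. (\<Prod>i\<in>UNIV. (x $ i) ^ a i))"
    by (rule integral_signed_permutation) (auto simp: e_def bij_id[unfolded id_def])
  ultimately show ?thesis
    by simp
qed

text \<open>
  Transpositions make the integral independent of the coordinate, and the squares add up to 1 on
  the unit sphere.
\<close>

lemma integral_square: "(LINT x|M. (x $ k)\<^sup>2) = measure M (space M) / CARD('n)"
proof -
  have integrable: "integrable M (\<lambda>x. (x $ i)\<^sup>2)" for i
  proof -
    have "(\<Prod>j\<in>UNIV. (x $ j) ^ (if j = i then 2 else 0)) = (x $ i)\<^sup>2" for x :: "real ^ 'n"
      by (simp add: if_distrib[of "power _"] cong: if_cong)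
    then show ?thesis
      using integrable_monomial[of "\<lambda>j. if j = i then 2 else 0"] by simp
  qed
  have same: "(LINT x|M. (x $ i)\<^sup>2) = (LINT x|M. (x $ k)\<^sup>2)" for i
    using integral_signed_permutation[of "Transposition.transpose i k" "\<lambda>_. 1" "\<lambda>x. (x $ k)\<^sup>2"]
    by (simp add: image_subset_iff)
  have "real CARD('n) * (LINT x|M. (x $ k)\<^sup>2) = (\<Sum>i\<in>UNIV. LINT x|M. (x $ i)\<^sup>2)"
    by (subst same) simp
  also have "\<dots> = (LINT x|M. (\<Sum>i\<in>UNIV. (x $ i)\<^sup>2))"
    by (simp add: integrable)
  also have "\<dots> = (LINT x|M. 1)"
  proof (rule Bochner_Integration.integral_cong)
    fix x assume "x \<in> space M"
    then have "norm x = 1"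
      using space_subset by auto
    then show "(\<Sum>i\<in>UNIV. (x $ i)\<^sup>2) = 1"
      by (simp add: norm_vec_def L2_set_def)
  qed simp
  finally show ?thesis
    by (simp add: field_simps)
qed

text \<open>
  The sum on the right is the trace of the quadratic form: in degree 2, the monomials with only
  even exponents are the squares of the coordinates.
\<close>

lemma integral_mpoly_eval_degree_2:
  fixes F :: "'n real_mpoly"
  assumes F: "homogeneous_mpoly 2 F"
  shows "(LINT x|M. mpoly_eval F x) = measure M (space M) / CARD('n) *
    (\<Sum>\<alpha> | \<alpha> \<in> Poly_Mapping.keys F \<and> (\<forall>i. even (Poly_Mapping.lookup \<alpha> i)). Poly_Mapping.lookup F \<alpha>)"
proof -
  let ?monomial = "\<lambda>\<alpha> x. \<Prod>i\<in>UNIV. (x $ i) ^ Poly_Mapping.lookup \<alpha> i"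
  let ?v = "measure M (space M) / CARD('n)"
  have monomial: "(LINT x|M. ?monomial \<alpha> x) = (if \<forall>i. even (Poly_Mapping.lookup \<alpha> i) then ?v else 0)"
    if \<alpha>: "\<alpha> \<in> Poly_Mapping.keys F" for \<alpha>
  proof (cases "\<forall>i. even (Poly_Mapping.lookup \<alpha> i)")
    case True
    have deg: "(\<Sum>i\<in>UNIV. Poly_Mapping.lookup \<alpha> i) = 2"
      using F \<alpha> by (simp add: homogeneous_mpoly_def)
    then obtain k where "Poly_Mapping.lookup \<alpha> k \<noteq> 0"
      by (metis sum.neutral zero_neq_numeral)
    with True have "Poly_Mapping.lookup \<alpha> k \<ge> 2"
      by (metis dvd_imp_le gr0I)
    moreover have "Poly_Mapping.lookup \<alpha> k + (\<Sum>i\<in>UNIV - {k}. Poly_Mapping.lookup \<alpha> i) = 2"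
      using deg sum.remove[of UNIV k "Poly_Mapping.lookup \<alpha>"] by simp
    ultimately have k: "Poly_Mapping.lookup \<alpha> k = 2"
      and "(\<Sum>i\<in>UNIV - {k}. Poly_Mapping.lookup \<alpha> i) = 0"
      by linarith+
    then have others: "Poly_Mapping.lookup \<alpha> i = 0" if "i \<noteq> k" for i
      using that by simp
    have "?monomial \<alpha> x = (x $ k)\<^sup>2" for x :: "real ^ 'n"
      using k others prod.remove[of UNIV k "\<lambda>i. (x $ i) ^ Poly_Mapping.lookup \<alpha> i"] by simp
    then show ?thesis
      using True by (simp add: integral_square)
  next
    case False
    then show ?thesis
      using integral_odd_monomial[of "Poly_Mapping.lookup \<alpha>"] by auto
  qed
  have "(LINT x|M. mpoly_eval F x)
      = (\<Sum>\<alpha>\<in>Poly_Mapping.keys F. Poly_Mapping.lookup F \<alpha> * (LINT x|M. ?monomial \<alpha> x))"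
    by (simp add: mpoly_eval_def integrable_monomial)
  also have "\<dots> = (\<Sum>\<alpha>\<in>Poly_Mapping.keys F.
      if \<forall>i. even (Poly_Mapping.lookup \<alpha> i) then ?v * Poly_Mapping.lookup F \<alpha> else 0)"
    by (intro sum.cong) (auto simp: monomial)
  also have "\<dots> = ?v *
    (\<Sum>\<alpha> | \<alpha> \<in> Poly_Mapping.keys F \<and> (\<forall>i. even (Poly_Mapping.lookup \<alpha> i)). Poly_Mapping.lookup F \<alpha>)"
    by (subst sum_distrib_left) (simp only: sum.inter_filter[OF finite_keys])
  finally show ?thesis .
qed

end

section \<open>Symmetry of the surface measure\<close>

text \<open>
  Lebesgue measure is determined by its values on boxes, and the preimage of a box is again a box,
  whose sides are the original ones in a different order.
\<close>

lemma distr_lborel_signed_permutation: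
  assumes p: "bij p" and e: "range e \<subseteq> {1, -1}"
  shows "distr lborel borel (signed_permutation e p) = (lborel :: (real ^ 'n::finite) measure)"
proof (rule lborel_eqI[symmetric])
  fix l u :: "real ^ 'n"
  assume "\<And>b. b \<in> Basis \<Longrightarrow> l \<bullet> b \<le> u \<bullet> b"
  then have lu: "l $ i \<le> u $ i" for i
    by (metis axis_in_Basis_iff insertI1 inner_axis Basis_real_def inner_real_def mult.right_neutral)
  have prod_Basis: "(\<Prod>b\<in>Basis. (y :: real ^ 'n) \<bullet> b) = (\<Prod>i\<in>UNIV. y $ i)" for y
  proof -
    have Basis: "(Basis :: (real ^ 'n) set) = (\<lambda>i. axis i 1) ` UNIV"
      by (auto simp: Basis_vec_def)
    have inj: "inj (\<lambda>i. axis i 1 :: real ^ 'n)"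
      by (auto simp: inj_on_def axis_eq_axis)
    show ?thesis
      unfolding Basis prod.reindex[OF inj] by (simp add: inner_axis)
  qed
  define q where "q = inv p"
  have pq: "p (q i) = i" and qp: "q (p i) = i" for i
    using p by (simp_all add: q_def bij_is_surj surj_f_inv_f bij_is_inj)
  have q: "bij q"
    using p by (simp add: q_def bij_imp_bij_inv)
  \<comment> \<open>A sign change swaps the two endpoints of the interval in that coordinate.\<close>
  define l' where "l' = (\<chi> k. if e (q k) = 1 then l $ q k else - u $ q k)"
  define u' where "u' = (\<chi> k. if e (q k) = 1 then u $ q k else - l $ q k)"
  have e_cases: "e i = 1 \<or> e i = -1" for i
    using e by auto
  have "signed_permutation e p x \<in> box l u \<longleftrightarrow> x \<in> box l' u'" for x
  proof -
    have coord: "l $ q k < e (q k) * x $ k \<and> e (q k) * x $ k < u $ q k \<longleftrightarrow>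
        l' $ k < x $ k \<and> x $ k < u' $ k" for k
      using e_cases[of "q k"] by (auto simp: l'_def u'_def)
    have "signed_permutation e p x \<in> box l u \<longleftrightarrow>
        (\<forall>i. l $ i < e i * x $ p i \<and> e i * x $ p i < u $ i)"
      by (simp add: mem_box_cart)
    also have "\<dots> \<longleftrightarrow> (\<forall>k. l $ q k < e (q k) * x $ k \<and> e (q k) * x $ k < u $ q k)"
      by (metis pq qp)
    finally show ?thesis
      by (simp add: coord mem_box_cart)
  qed
  then have preimage: "signed_permutation e p -` box l u = box l' u'"
    by auto
  have side: "(u' - l') $ k = (u - l) $ q k" for k
    by (simp add: l'_def u'_def)
  have le: "l' \<bullet> b \<le> u' \<bullet> b" if b: "b \<in> Basis" for b
  proof -
    obtain k where "b = axis k 1"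
      using b by (auto simp: Basis_vec_def)
    then show ?thesis
      using lu[of "q k"] by (simp add: inner_axis l'_def u'_def)
  qed
  have "emeasure (distr lborel borel (signed_permutation e p)) (box l u) = emeasure lborel (box l' u')"
    by (simp add: emeasure_distr preimage)
  also have "\<dots> = (\<Prod>b\<in>Basis. (u' - l') \<bullet> b)"
    using le by (rule emeasure_lborel_box)
  also have "\<dots> = (\<Prod>k\<in>UNIV. (u - l) $ q k)"
    by (simp only: prod_Basis side)
  also have "\<dots> = (\<Prod>i\<in>UNIV. (u - l) $ i)"
    using prod.reindex_bij_betw[OF q] by (rule arg_cong)
  finally show "emeasure (distr lborel borel (signed_permutation e p)) (box l u)
      = (\<Prod>b\<in>Basis. (u - l) \<bullet> b)"
    by (simp only: prod_Basis)
qed simp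

text \<open>
  The surface measure of a set is a multiple of the Lebesgue measure of the cone over it.  Signed
  permutations are linear and preserve the norm, so the cone over a preimage is the preimage of the
  cone, and the invariance of Lebesgue measure carries over.
\<close>

lemma signed_permutation_invariant_measure_sphere_measure:
  "signed_permutation_invariant_measure (sphere_measure :: (real ^ 'n::finite) measure)"
proof -
  let ?S = "sphere_measure :: (real ^ 'n) measure"
  have measurable: "signed_permutation e p \<in> measurable ?S ?S"
    if "bij p" "range e \<subseteq> {1, -1}" for e and p :: "'n \<Rightarrow> 'n"
  proof -
    have "signed_permutation e p
        \<in> measurable (restrict_space borel (sphere 0 1)) (restrict_space borel (sphere 0 1))"
      by (intro measurable_restrict_space3) (auto simp: norm_signed_permutation[OF that])
    then show ?thesis
      by (simp cong: measurable_cong_sets add: sets_sphere_measure)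
  qed
  show ?thesis
  proof (intro signed_permutation_invariant_measure.intro
      signed_permutation_invariant_measure_axioms.intro finite_measureI)
    show "emeasure ?S (space ?S) \<noteq> \<infinity>"
      by (simp add: emeasure_sphere_measure_sphere)
    show "space ?S \<subseteq> sphere 0 1"
      by simp
    show "(\<lambda>x. x) \<in> borel_measurable ?S"
      using measurable_restrict_space1[OF measurable_ident, of borel "sphere 0 1"]
      by (simp add: id_def cong: measurable_cong_sets[OF sets_sphere_measure refl])
    fix p :: "'n \<Rightarrow> 'n" and e :: "'n \<Rightarrow> real"
    assume p: "bij p" and e: "range e \<subseteq> {1, -1}"
    let ?s = "signed_permutation e p"
    show "?s \<in> measurable ?S ?S"
      using p e by (rule measurable)
    show "distr ?S ?S ?s = ?S"
    proof (rule measure_eqI)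
      fix A assume "A \<in> sets (distr ?S ?S ?s)"
      then have A: "A \<in> sets ?S"
        by simp
      define C where "C = {x \<in> ball 0 1 - {0 :: real ^ 'n}. sgn x \<in> A}"
      have "A \<in> sets borel"
        using A by (auto simp: sets_sphere_measure sets_restrict_space_iff)
      then have "sgn -` A \<inter> space borel \<in> sets (borel :: (real ^ 'n) measure)"
        by (intro measurable_sets[of _ _ borel]) (auto simp: sgn_div_norm)
      moreover have "C = (ball 0 1 - {0}) \<inter> (sgn -` A \<inter> space borel)"
        by (auto simp: C_def)
      ultimately have C: "C \<in> sets borel"
        by auto
      have norm: "norm (?s x) = norm x" for x
        using p e by (rule norm_signed_permutation)
      have sgn: "sgn (?s x) = ?s (sgn x)" for x
        by (simp add: sgn_div_norm norm linear_cmul[OF linear_signed_permutation])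
      have zero: "?s x = 0 \<longleftrightarrow> x = 0" for x
        using norm[of x] by (metis norm_eq_zero)
      have cone: "{x \<in> ball 0 1 - {0}. sgn x \<in> ?s -` A \<inter> space ?S} = ?s -` C"
        by (auto simp: C_def norm sgn zero norm_sgn)
      have "emeasure (distr ?S ?S ?s) A = emeasure ?S (?s -` A \<inter> space ?S)"
        using measurable[OF p e] A by (rule emeasure_distr)
      also have "\<dots> = of_nat DIM(real ^ 'n) * emeasure lborel (?s -` C)"
        using emeasure_sphere_measure[OF measurable_sets[OF measurable[OF p e] A]]
        by (simp only: cone)
      also have "emeasure lborel (?s -` C) = emeasure (distr lborel borel ?s) C"
        using C by (simp add: emeasure_distr)
      also have "\<dots> = emeasure lborel C"
        by (simp only: distr_lborel_signed_permutation[OF p e])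
      also have "of_nat DIM(real ^ 'n) * emeasure lborel C = emeasure ?S A"
        using emeasure_sphere_measure[OF A] by (simp only: C_def)
      finally show "emeasure (distr ?S ?S ?s) A = emeasure ?S A" .
    qed simp
  qed
qed

section \<open>Symmetry of the mid-points\<close>

lemma mid_points_nonempty:
  assumes "m \<le> CARD('n::finite)"
  shows "(mid_points m :: (real ^ 'n) set) \<noteq> {}"
proof -
  obtain A :: "'n set" where A: "card A = m"
    using obtain_subset_with_card_n[OF assms] by auto
  have "(\<chi> i. if i \<in> A then 1 / sqrt (real m) else 0) \<in> mid_points m"
  proof (cases "m = 0")
    case False
    with A show ?thesis
      by (simp add: mid_points_def)
  qed (simp add: mid_points_def)
  then show ?thesis
    by blast
qed

lemma signed_permutation_mid_points:
  assumes p: "bij p" and e: "range e \<subseteq> {1, -1}" and x: "x \<in> mid_points m"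
  shows "signed_permutation e p x \<in> mid_points m"
proof -
  have e_cases: "e i = 1 \<or> e i = -1" for i
    using e by auto
  then have "e i \<noteq> 0" for i
    by (metis zero_neq_neg_one zero_neq_one)
  then have "{i. signed_permutation e p x $ i \<noteq> 0} = p -` {i. x $ i \<noteq> 0}"
    by auto
  then have "card {i. signed_permutation e p x $ i \<noteq> 0} = card {i. x $ i \<noteq> 0}"
    by (simp only: card_vimage_inj bij_is_inj[OF p] bij_is_surj[OF p] subset_UNIV)
  moreover have "signed_permutation e p x $ i = 1 / sqrt (real m) \<or>
      signed_permutation e p x $ i = - (1 / sqrt (real m))"
    if "signed_permutation e p x $ i \<noteq> 0" for i
    using that x e_cases[of i] by (auto simp: mid_points_def)
  ultimately show ?thesis
    using x by (simp add: mid_points_def)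
qed

lemma signed_permutation_invariant_measure_mid_points:
  assumes "0 < m"
  shows "signed_permutation_invariant_measure (count_space (mid_points m :: (real ^ 'n::finite) set))"
proof (intro signed_permutation_invariant_measure.intro
    signed_permutation_invariant_measure_axioms.intro finite_measureI)
  let ?M = "mid_points m :: (real ^ 'n) set"
  show "emeasure (count_space ?M) (space (count_space ?M)) \<noteq> \<infinity>"
    by (simp add: finite_mid_points)
  show "space (count_space ?M) \<subseteq> sphere 0 1"
    using mid_points_subset_sphere[OF assms] by simp
  show "(\<lambda>x. x) \<in> borel_measurable (count_space ?M)"
    by simp
  fix p :: "'n \<Rightarrow> 'n" and e :: "'n \<Rightarrow> real"
  assume p: "bij p" and e: "range e \<subseteq> {1, -1}"
  have maps: "signed_permutation e p ` ?M \<subseteq> ?M"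
    using signed_permutation_mid_points[OF p e] by blast
  then show "signed_permutation e p \<in> measurable (count_space ?M) (count_space ?M)"
    by auto
  \<comment> \<open>An injective self-map of a finite set is a bijection.\<close>
  have inj: "inj_on (signed_permutation e p) ?M"
    using bij_signed_permutation[OF p e] by (meson bij_is_inj inj_on_subset subset_UNIV)
  then have "bij_betw (signed_permutation e p) ?M ?M"
    using maps by (simp add: bij_betw_def endo_inj_surj finite_mid_points)
  then show "distr (count_space ?M) (count_space ?M) (signed_permutation e p) = count_space ?M"
    by (rule distr_bij_count_space)
qed

section \<open>The spherical mean of a quadratic form\<close>

theorem theorem2p9:
  fixes F :: "'n::finite real_mpoly" and n m :: nat
  assumes "1 \<le> n" and "CARD('n) = n + 1"
    and "homogeneous_mpoly 2 F"
    and "1 \<le> m" and "m \<le> n"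
  shows "1 / measure sphere_measure (sphere (0 :: real ^ 'n) 1)
           * (LINT x|sphere_measure. mpoly_eval F x)
       = 1 / real (card (mid_points m :: (real ^ 'n) set))
           * (\<Sum>x\<in>mid_points m. mpoly_eval F x)"
proof -
  let ?M = "mid_points m :: (real ^ 'n) set"
  let ?trace = "\<Sum>\<alpha> | \<alpha> \<in> Poly_Mapping.keys F \<and> (\<forall>i. even (Poly_Mapping.lookup \<alpha> i)).
    Poly_Mapping.lookup F \<alpha>"
  interpret sphere: signed_permutation_invariant_measure "sphere_measure :: (real ^ 'n) measure"
    by (rule signed_permutation_invariant_measure_sphere_measure)
  interpret mid: signed_permutation_invariant_measure "count_space ?M"
    using assms(4) by (intro signed_permutation_invariant_measure_mid_points) simp
  have "(LINT x|sphere_measure. mpoly_eval F x)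
      = measure sphere_measure (sphere (0 :: real ^ 'n) 1) / CARD('n) * ?trace"
    using sphere.integral_mpoly_eval_degree_2[OF assms(3)] by simp
  moreover have "measure sphere_measure (sphere (0 :: real ^ 'n) 1) \<noteq> 0"
    by (simp add: measure_def emeasure_sphere_measure_sphere less_imp_neq[OF unit_ball_vol_pos, symmetric])
  moreover have "(\<Sum>x\<in>?M. mpoly_eval F x) = card ?M / CARD('n) * ?trace"
    using mid.integral_mpoly_eval_degree_2[OF assms(3)]
    by (simp add: lebesgue_integral_count_space_finite finite_mid_points measure_count_space)
  moreover have "card ?M \<noteq> 0"
    using mid_points_nonempty[where 'n = 'n, of m] assms by (simp add: finite_mid_points)
  ultimately show ?thesis
    by simp
qed

end
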